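(* Let $K$ and $L$ be finite abstract simplicial complexes and let $K\times L$ be their categorical product. Then $$\mathrm{scat}(K\times L)+1\leq(\mathrm{scat}\,K+1)(\mathrm{scat}\,L+1).$$
   Context: Two simplicial maps $\varphi,\psi\colon K\to L$ between abstract simplicial complexes are contiguous, $\varphi\sim_c\psi$, if for every simplex $\sigma$ of $K$ the set of vertices $\varphi(\sigma)\cup\psi(\sigma)$ is a simplex of $L$. They are in the same contiguity class, $\varphi\sim\psi$, if there is a finite sequence of simplicial maps $\varphi=\varphi_1\sim_c\varphi_2\sim_c\cdots\sim_c\varphi_m=\psi$ from $K$ to $L$. A subcomplex $U\subset K$ is categorical (in $K$) if there is a vertex $v\in K$ such that the inclusion $U\to K$ and the constant map $c_v\colon U\to K$ with value $v$ are in the same contiguity class. The simplicial LS-category $\mathrm{scat}\, K$ is the least integer $n\geq 0$ such that $K=U_0\cup\cdots\cup U_n$ for some $n+1$ categorical subcomplexes $U_0,\dots,U_n$ of $K$. Complexes are assumed nonempty. The categorical product $K\times L$ is the abstract simplicial complex whose vertices are the pairs $(v,w)$ with $v$ a vertex of $K$ and $w$ a vertex of $L$, and whose simplices are the sets $\{(v_1,w_1),\dots,(v_q,w_q)\}$ such that $\{v_1,\dots,v_q\}$ is a simplex of $K$ and $\{w_1,\dots,w_q\}$ is a simplex of $L$ (repetitions among the $v_i$ or among the $w_i$ are allowed). *)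

theory Defs
  imports Main
begin

text \<open>
  An abstract simplicial complex is represented by its set of simplices, all of them nonempty.
  Complexes are nonempty by convention. The vertices are the elements of the simplices; by
  downward closure these are exactly the \<open>v\<close> with \<open>{v} \<in> K\<close>.
\<close>

definition abstract_complex :: "'a set set \<Rightarrow> bool" where
  "abstract_complex K \<longleftrightarrow>
     K \<noteq> {} \<and>
     (\<forall>\<sigma>\<in>K. finite \<sigma> \<and> \<sigma> \<noteq> {}) \<and>
     (\<forall>\<sigma>\<in>K. \<forall>\<tau>. \<tau> \<subseteq> \<sigma> \<and> \<tau> \<noteq> {} \<longrightarrow> \<tau> \<in> K)"

definition vertices :: "'a set set \<Rightarrow> 'a set" where
  "vertices K = \<Union>K"

definition subcomplex :: "'a set set \<Rightarrow> 'a set set \<Rightarrow> bool" where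
  "subcomplex U K \<longleftrightarrow> abstract_complex U \<and> U \<subseteq> K"

text \<open>
  Vertex maps are total HOL functions; only their values on the vertices of \<open>K\<close> matter. Two
  simplicial maps that agree on the vertices of \<open>K\<close> are contiguous, so \<open>same_contiguity_class\<close>
  below does not depend on the irrelevant values either.
\<close>

definition simplicial_map :: "'a set set \<Rightarrow> 'b set set \<Rightarrow> ('a \<Rightarrow> 'b) \<Rightarrow> bool" where
  "simplicial_map K L \<phi> \<longleftrightarrow> (\<forall>\<sigma>\<in>K. \<phi> ` \<sigma> \<in> L)"

definition contiguous ::
    "'a set set \<Rightarrow> 'b set set \<Rightarrow> ('a \<Rightarrow> 'b) \<Rightarrow> ('a \<Rightarrow> 'b) \<Rightarrow> bool" where
  "contiguous K L \<phi> \<psi> \<longleftrightarrow>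
     simplicial_map K L \<phi> \<and> simplicial_map K L \<psi> \<and> (\<forall>\<sigma>\<in>K. \<phi> ` \<sigma> \<union> \<psi> ` \<sigma> \<in> L)"

definition same_contiguity_class ::
    "'a set set \<Rightarrow> 'b set set \<Rightarrow> ('a \<Rightarrow> 'b) \<Rightarrow> ('a \<Rightarrow> 'b) \<Rightarrow> bool" where
  "same_contiguity_class K L \<phi> \<psi> \<longleftrightarrow>
     (\<exists>(m::nat) \<Phi>. \<Phi> 0 = \<phi> \<and> \<Phi> m = \<psi> \<and>
        (\<forall>i\<le>m. simplicial_map K L (\<Phi> i)) \<and>
        (\<forall>i<m. contiguous K L (\<Phi> i) (\<Phi> (Suc i))))"

definition categorical :: "'a set set \<Rightarrow> 'a set set \<Rightarrow> bool" where
  "categorical K U \<longleftrightarrow>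
     subcomplex U K \<and>
     (\<exists>v\<in>vertices K. same_contiguity_class U K (\<lambda>x. x) (\<lambda>_. v))"

definition categorical_cover :: "'a set set \<Rightarrow> nat \<Rightarrow> (nat \<Rightarrow> 'a set set) \<Rightarrow> bool" where
  "categorical_cover K n U \<longleftrightarrow> (\<forall>i\<le>n. categorical K (U i)) \<and> K = (\<Union>i\<le>n. U i)"

text \<open>
  The value is meaningful whenever some categorical cover exists, in particular for every finite
  complex (\<open>ex_categorical_cover\<close>).
\<close>

definition scat :: "'a set set \<Rightarrow> nat" where
  "scat K = (LEAST n. \<exists>U. categorical_cover K n U)"

lemma ex_categorical_cover:
  assumes K: "abstract_complex K" and fin: "finite K"
  shows "\<exists>n U. categorical_cover K n U"
proof -
  define face where "face \<sigma> = {\<tau>. \<tau> \<noteq> {} \<and> \<tau> \<subseteq> \<sigma>}" for \<sigma> :: "'a set"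
  have face_sub: "face \<sigma> \<subseteq> K" if "\<sigma> \<in> K" for \<sigma>
    using K that unfolding abstract_complex_def face_def by blast
  have cat: "categorical K (face \<sigma>)" if s: "\<sigma> \<in> K" for \<sigma>
  proof -
    have fs: "finite \<sigma>" "\<sigma> \<noteq> {}"
      using K s unfolding abstract_complex_def by auto
    then obtain v where v: "v \<in> \<sigma>" by blast
    have "abstract_complex (face \<sigma>)"
      using fs unfolding abstract_complex_def face_def by (auto intro: finite_subset)
    then have "subcomplex (face \<sigma>) K"
      using face_sub[OF s] by (simp add: subcomplex_def)
    moreover have "v \<in> vertices K"
      using v s by (auto simp: vertices_def)
    moreover have "same_contiguity_class (face \<sigma>) K (\<lambda>x. x) (\<lambda>_. v)"
    proof -
      have in_K: "\<tau> \<in> K" if "\<tau> \<noteq> {}" "\<tau> \<subseteq> \<sigma>" for \<tau>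
        using face_sub[OF s] that by (auto simp: face_def)
      have s1: "simplicial_map (face \<sigma>) K (\<lambda>x. x)"
        by (auto simp: simplicial_map_def face_def intro!: in_K)
      have s2: "simplicial_map (face \<sigma>) K (\<lambda>_. v)"
        using v by (auto simp: simplicial_map_def face_def intro!: in_K)
      have "contiguous (face \<sigma>) K (\<lambda>x. x) (\<lambda>_. v)"
        using s1 s2 v by (auto simp: contiguous_def face_def intro!: in_K)
      then show ?thesis
        unfolding same_contiguity_class_def using s1 s2
        by (intro exI[of _ 1] exI[of _ "\<lambda>i. if i = 0 then (\<lambda>x. x) else (\<lambda>_. v)"]) auto
    qed
    ultimately show ?thesis unfolding categorical_def by blast
  qed
  obtain n :: nat and f where f: "K = f ` {i. i < n}"
    using finite_imp_nat_seg_image_inj_on[OF fin] by blast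
  have "n \<noteq> 0" using K f unfolding abstract_complex_def by auto
  then have seg: "{i. i < n} = {..n - 1}" by auto
  have "K = (\<Union>i\<le>n - 1. face (f i))"
  proof
    show "(\<Union>i\<le>n - 1. face (f i)) \<subseteq> K" using face_sub f seg by blast
    show "K \<subseteq> (\<Union>i\<le>n - 1. face (f i))"
    proof
      fix \<tau> assume "\<tau> \<in> K"
      then obtain i where "i \<le> n - 1" "\<tau> = f i" using f seg by auto
      moreover have "\<tau> \<noteq> {}" using K \<open>\<tau> \<in> K\<close> unfolding abstract_complex_def by auto
      ultimately show "\<tau> \<in> (\<Union>i\<le>n - 1. face (f i))" by (auto simp: face_def)
    qed
  qed
  moreover have "categorical K (face (f i))" if "i \<le> n - 1" for i
    using that f seg by (intro cat) auto
  ultimately have "categorical_cover K (n - 1) (\<lambda>i. face (f i))"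
    by (simp add: categorical_cover_def)
  then show ?thesis by blast
qed

text \<open>
  A finite set of pairs \<open>(v\<^sub>i, w\<^sub>i)\<close> has \<open>{v\<^sub>1, \<dots>, v\<^sub>q}\<close> and \<open>{w\<^sub>1, \<dots>, w\<^sub>q}\<close> as its images under
  the projections. Finiteness and nonemptiness of \<open>\<sigma>\<close> follow from those of the projections.
\<close>

definition categorical_product :: "'a set set \<Rightarrow> 'b set set \<Rightarrow> ('a \<times> 'b) set set" where
  "categorical_product K L = {\<sigma>. fst ` \<sigma> \<in> K \<and> snd ` \<sigma> \<in> L}"

lemma abstract_complex_categorical_product:
  assumes K: "abstract_complex K" and L: "abstract_complex L"
  shows "abstract_complex (categorical_product K L)"
proof -
  note K' = K[unfolded abstract_complex_def] and L' = L[unfolded abstract_complex_def]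
  have fin: "finite \<sigma>" "\<sigma> \<noteq> {}" if "\<sigma> \<in> K" for \<sigma>
    using K'[THEN conjunct2, THEN conjunct1, THEN bspec, OF that] by simp_all
  have fin': "finite \<tau>" "\<tau> \<noteq> {}" if "\<tau> \<in> L" for \<tau>
    using L'[THEN conjunct2, THEN conjunct1, THEN bspec, OF that] by simp_all
  have down: "\<tau> \<in> K" if "\<sigma> \<in> K" "\<tau> \<subseteq> \<sigma>" "\<tau> \<noteq> {}" for \<sigma> \<tau>
    using K'[THEN conjunct2, THEN conjunct2, THEN bspec, OF that(1)] that(2,3) by iprover
  have down': "\<tau> \<in> L" if "\<sigma> \<in> L" "\<tau> \<subseteq> \<sigma>" "\<tau> \<noteq> {}" for \<sigma> \<tau>
    using L'[THEN conjunct2, THEN conjunct2, THEN bspec, OF that(1)] that(2,3) by iprover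
  obtain \<sigma> \<tau> where st: "\<sigma> \<in> K" "\<tau> \<in> L"
    using K'[THEN conjunct1] L'[THEN conjunct1] by blast
  have "\<sigma> \<times> \<tau> \<in> categorical_product K L"
    using st fin(2)[OF st(1)] fin'(2)[OF st(2)] by (simp add: categorical_product_def)
  then have "categorical_product K L \<noteq> {}" by auto
  moreover have "finite \<rho> \<and> \<rho> \<noteq> {}" if r: "\<rho> \<in> categorical_product K L" for \<rho>
  proof -
    have r': "fst ` \<rho> \<in> K" "snd ` \<rho> \<in> L"
      using r by (simp_all add: categorical_product_def)
    have "\<rho> \<subseteq> fst ` \<rho> \<times> snd ` \<rho>" by (rule subset_fst_snd)
    moreover have "finite (fst ` \<rho> \<times> snd ` \<rho>)"
      using fin(1)[OF r'(1)] fin'(1)[OF r'(2)] by (rule finite_cartesian_product)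
    ultimately have "finite \<rho>" by (rule finite_subset)
    then show ?thesis using fin(2)[OF r'(1)] by simp
  qed
  moreover have "\<tau> \<in> categorical_product K L"
    if r: "\<rho> \<in> categorical_product K L" and "\<tau> \<subseteq> \<rho>" "\<tau> \<noteq> {}" for \<rho> \<tau>
  proof -
    have r': "fst ` \<rho> \<in> K" "snd ` \<rho> \<in> L"
      using r by (simp_all add: categorical_product_def)
    have "fst ` \<tau> \<in> K" "snd ` \<tau> \<in> L"
      by (rule down[OF r'(1)] down'[OF r'(2)]; use that(2,3) in \<open>simp add: image_mono\<close>)+
    then show ?thesis by (simp add: categorical_product_def)
  qed
  ultimately show ?thesis unfolding abstract_complex_def by blast
qed

lemma vertices_categorical_product:
  assumes K: "abstract_complex K" and L: "abstract_complex L"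
  shows "vertices (categorical_product K L) = vertices K \<times> vertices L"
proof
  show "vertices (categorical_product K L) \<subseteq> vertices K \<times> vertices L"
  proof
    fix p assume "p \<in> vertices (categorical_product K L)"
    then obtain \<rho> where r: "p \<in> \<rho>" "fst ` \<rho> \<in> K" "snd ` \<rho> \<in> L"
      unfolding vertices_def categorical_product_def by blast
    have "fst p \<in> vertices K" "snd p \<in> vertices L"
      unfolding vertices_def
      using UnionI[OF r(2) imageI[OF r(1)]] UnionI[OF r(3) imageI[OF r(1)]] by simp_all
    then show "p \<in> vertices K \<times> vertices L" by (simp add: mem_Times_iff)
  qed
  have single: "{v} \<in> M" if "abstract_complex M" "v \<in> vertices M" for v and M :: "'c set set"
    using that unfolding vertices_def abstract_complex_def by auto
  have "{(v, w)} \<in> categorical_product K L" if "v \<in> vertices K" "w \<in> vertices L" for v w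
    using single[OF K that(1)] single[OF L that(2)] by (simp add: categorical_product_def)
  then show "vertices K \<times> vertices L \<subseteq> vertices (categorical_product K L)"
    unfolding vertices_def by blast
qed

lemma finite_categorical_product:
  assumes K: "abstract_complex K" "finite K" and L: "abstract_complex L" "finite L"
  shows "finite (categorical_product K L)"
proof -
  have "finite (vertices K)" "finite (vertices L)"
    using assms by (auto simp: vertices_def abstract_complex_def)
  then have "finite (Pow (vertices (categorical_product K L)))"
    using K(1) L(1) by (simp add: vertices_categorical_product)
  moreover have "categorical_product K L \<subseteq> Pow (vertices (categorical_product K L))"
    by (auto simp: vertices_def)
  ultimately show ?thesis by (rule rev_finite_subset)
qed

end

theory Submission
  imports Defs
begin

text \<open>
  If \<open>U\<close> contracts in \<open>K\<close> along a sequence \<open>\<Phi>\<close> of contiguities and \<open>V\<close> contracts in \<open>L\<close> along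
  \<open>\<Psi>\<close>, then the maps \<open>\<Phi>\<^sub>i \<times> \<Psi>\<^sub>i\<close> contract \<open>U \<times> V\<close> in \<open>K \<times> L\<close>, the shorter sequence being continued
  constantly. So the products of the members of two categorical covers form a categorical cover
  of \<open>K \<times> L\<close>.
\<close>

lemma contiguous_refl: "simplicial_map K L \<phi> \<Longrightarrow> contiguous K L \<phi> \<phi>"
  by (simp add: contiguous_def simplicial_map_def)

lemma map_prod_image_categorical_product:
  "map_prod f g ` \<sigma> \<in> categorical_product K L \<longleftrightarrow> f ` fst ` \<sigma> \<in> K \<and> g ` snd ` \<sigma> \<in> L"
  by (simp add: categorical_product_def image_image)

lemma map_prod_images_categorical_product:
  "map_prod f g ` \<sigma> \<union> map_prod f' g' ` \<sigma> \<in> categorical_product K L \<longleftrightarrow>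
    f ` fst ` \<sigma> \<union> f' ` fst ` \<sigma> \<in> K \<and> g ` snd ` \<sigma> \<union> g' ` snd ` \<sigma> \<in> L"
  by (simp add: categorical_product_def image_Un image_image)

text \<open>A set lies in a categorical product iff both its projections lie in the factors, and
  \<open>map_prod\<close> commutes with projecting. Contiguity can therefore be checked in each
  factor separately.\<close>

lemma contiguous_map_prod:
  assumes "contiguous U K \<phi> \<phi>'" and "contiguous V L \<psi> \<psi>'"
  shows "contiguous (categorical_product U V) (categorical_product K L)
    (map_prod \<phi> \<psi>) (map_prod \<phi>' \<psi>')"
  unfolding contiguous_def simplicial_map_def map_prod_image_categorical_product
    map_prod_images_categorical_product
  using assms unfolding contiguous_def simplicial_map_def categorical_product_def by blast

text \<open>Turns the finite sequence into an infinite, eventually constant one, so that sequences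
  of different lengths can be run in parallel.\<close>

lemma same_contiguity_classE:
  assumes "same_contiguity_class K L \<phi> \<psi>"
  obtains m \<Phi> where "\<Phi> 0 = \<phi>" "\<And>i. m \<le> i \<Longrightarrow> \<Phi> i = \<psi>" "\<And>i. contiguous K L (\<Phi> i) (\<Phi> (Suc i))"
proof -
  obtain m \<Phi> where \<Phi>: "\<Phi> 0 = \<phi>" "\<Phi> m = \<psi>"
    and simp: "\<And>i. i \<le> m \<Longrightarrow> simplicial_map K L (\<Phi> i)"
    and step: "\<And>i. i < m \<Longrightarrow> contiguous K L (\<Phi> i) (\<Phi> (Suc i))"
    using assms unfolding same_contiguity_class_def by blast
  show thesis
  proof (rule that[of "\<lambda>i. \<Phi> (min i m)" m])
    fix i
    \<comment> \<open>For \<open>i \<ge> m\<close> both indices collapse to \<open>m\<close>, so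
      what is needed is that \<open>\<Phi> m\<close> is simplicial; this is available even if
      \<open>m = 0\<close>.\<close>
    show "contiguous K L (\<Phi> (min i m)) (\<Phi> (min (Suc i) m))"
      using step[of i] contiguous_refl[OF simp[of m]] by (cases "i < m") (simp_all add: min_def)
  qed (simp_all add: \<Phi> min_def)
qed

lemma same_contiguity_class_map_prod:
  assumes "same_contiguity_class U K \<phi> \<phi>'" and "same_contiguity_class V L \<psi> \<psi>'"
  shows "same_contiguity_class (categorical_product U V) (categorical_product K L)
    (map_prod \<phi> \<psi>) (map_prod \<phi>' \<psi>')"
proof -
  obtain m \<Phi> where \<Phi>: "\<Phi> 0 = \<phi>" "\<And>i. m \<le> i \<Longrightarrow> \<Phi> i = \<phi>'"
      "\<And>i. contiguous U K (\<Phi> i) (\<Phi> (Suc i))"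
    using same_contiguity_classE[OF assms(1)] by blast
  obtain n \<Psi> where \<Psi>: "\<Psi> 0 = \<psi>" "\<And>i. n \<le> i \<Longrightarrow> \<Psi> i = \<psi>'"
      "\<And>i. contiguous V L (\<Psi> i) (\<Psi> (Suc i))"
    using same_contiguity_classE[OF assms(2)] by blast
  have "contiguous (categorical_product U V) (categorical_product K L)
      (map_prod (\<Phi> i) (\<Psi> i)) (map_prod (\<Phi> (Suc i)) (\<Psi> (Suc i)))" for i
    by (intro contiguous_map_prod \<Phi> \<Psi>)
  moreover from this have "simplicial_map (categorical_product U V) (categorical_product K L)
      (map_prod (\<Phi> i) (\<Psi> i))" for i
    unfolding contiguous_def by blast
  ultimately show ?thesis
    unfolding same_contiguity_class_def
    \<comment> \<open>From index \<open>max m n\<close> on, both sequences have reached their final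
      maps.\<close>
    by (intro exI[of _ "max m n"] exI[of _ "\<lambda>i. map_prod (\<Phi> i) (\<Psi> i)"]) (simp add: \<Phi> \<Psi>)
qed

lemma subcomplex_categorical_product:
  assumes "subcomplex U K" and "subcomplex V L"
  shows "subcomplex (categorical_product U V) (categorical_product K L)"
  using assms abstract_complex_categorical_product
  by (auto simp: subcomplex_def categorical_product_def)

lemma categorical_categorical_product:
  assumes K: "abstract_complex K" and L: "abstract_complex L"
    and U: "categorical K U" and V: "categorical L V"
  shows "categorical (categorical_product K L) (categorical_product U V)"
proof -
  obtain v where v: "v \<in> vertices K" "same_contiguity_class U K (\<lambda>x. x) (\<lambda>_. v)"
    using U unfolding categorical_def by blast
  obtain w where w: "w \<in> vertices L" "same_contiguity_class V L (\<lambda>x. x) (\<lambda>_. w)"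
    using V unfolding categorical_def by blast
  \<comment> \<open>These equations turn the product of the two contractions into a contraction to
    the vertex \<open>(v, w)\<close>.\<close>
  have "map_prod (\<lambda>x. x) (\<lambda>x. x) = (\<lambda>x::'a \<times> 'b. x)"
    and "map_prod (\<lambda>_. v) (\<lambda>_. w) = (\<lambda>_::'a \<times> 'b. (v, w))"
    by auto
  then have "same_contiguity_class (categorical_product U V) (categorical_product K L)
      (\<lambda>x. x) (\<lambda>_. (v, w))"
    using same_contiguity_class_map_prod[OF v(2) w(2)] by simp
  moreover have "(v, w) \<in> vertices (categorical_product K L)"
    using v w by (simp add: vertices_categorical_product K L)
  moreover have "subcomplex (categorical_product U V) (categorical_product K L)"
    using U V by (simp add: categorical_def subcomplex_categorical_product)
  ultimately show ?thesis
    unfolding categorical_def by blast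
qed

text \<open>The pair \<open>(i, j)\<close> with \<open>i \<le> m\<close> and
  \<open>j \<le> n\<close> is coded by \<open>k = i * Suc n + j\<close> and recovered by
  \<open>div\<close> and \<open>mod\<close>. Counting starts at 0, so the last code is one less than
  the number of pairs.\<close>

lemma categorical_cover_categorical_product:
  assumes K: "abstract_complex K" and L: "abstract_complex L"
    and U: "categorical_cover K m U" and V: "categorical_cover L n V"
  shows "categorical_cover (categorical_product K L) (Suc m * Suc n - 1)
    (\<lambda>k. categorical_product (U (k div Suc n)) (V (k mod Suc n)))"
proof -
  \<comment> \<open>The product is positive, so the truncated subtraction is harmless and the bound
    on \<open>k\<close> amounts to \<open>k < Suc m * Suc n\<close>.\<close>
  have range: "k \<le> Suc m * Suc n - 1 \<longleftrightarrow> k div Suc n \<le> m" for k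
    using div_less_iff_less_mult[of "Suc n" k "Suc m"] by auto
  have mod: "k mod Suc n \<le> n" for k
    using mod_less_divisor[of "Suc n" k] by simp
  have "categorical_product K L =
      (\<Union>k\<le>Suc m * Suc n - 1. categorical_product (U (k div Suc n)) (V (k mod Suc n)))"
  proof (intro equalityI subsetI)
    fix \<sigma> assume "\<sigma> \<in> categorical_product K L"
    then obtain i j where ij: "i \<le> m" "fst ` \<sigma> \<in> U i" "j \<le> n" "snd ` \<sigma> \<in> V j"
      using U V by (auto simp: categorical_product_def categorical_cover_def)
    moreover have "(i * Suc n + j) div Suc n = i" "(i * Suc n + j) mod Suc n = j"
      \<comment> \<open>Expanding \<open>i * Suc n\<close> would hide the multiple of the divisor
        from the \<open>div\<close> and \<open>mod\<close> rules.\<close>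
      using \<open>j \<le> n\<close> by (simp_all del: mult_Suc_right)
    ultimately show "\<sigma> \<in> (\<Union>k\<le>Suc m * Suc n - 1.
        categorical_product (U (k div Suc n)) (V (k mod Suc n)))"
      by (intro UN_I[of "i * Suc n + j"])
        (simp_all only: atMost_iff range categorical_product_def mem_Collect_eq)
  next
    fix \<sigma> assume "\<sigma> \<in> (\<Union>k\<le>Suc m * Suc n - 1.
        categorical_product (U (k div Suc n)) (V (k mod Suc n)))"
    then obtain k where "k div Suc n \<le> m"
        "fst ` \<sigma> \<in> U (k div Suc n)" "snd ` \<sigma> \<in> V (k mod Suc n)"
      unfolding UN_iff Bex_def atMost_iff range categorical_product_def mem_Collect_eq
      by iprover
    moreover have "K = (\<Union>i\<le>m. U i)" "L = (\<Union>i\<le>n. V i)"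
      using U V unfolding categorical_cover_def by simp_all
    ultimately show "\<sigma> \<in> categorical_product K L"
      using mod[of k] by (auto simp only: categorical_product_def)
  qed
  moreover have "categorical (categorical_product K L)
      (categorical_product (U (k div Suc n)) (V (k mod Suc n)))" if "k div Suc n \<le> m" for k
  proof (rule categorical_categorical_product[OF K L])
    show "categorical K (U (k div Suc n))"
      using U that unfolding categorical_cover_def by iprover
    show "categorical L (V (k mod Suc n))"
      using V mod[of k] unfolding categorical_cover_def by iprover
  qed
  ultimately show ?thesis
    unfolding categorical_cover_def range by iprover
qed

theorem theorem5p1p4:
  fixes K :: "'a set set" and L :: "'b set set"
  assumes "abstract_complex K" and "finite K"
    and "abstract_complex L" and "finite L"
  shows "scat (categorical_product K L) + 1 \<le> (scat K + 1) * (scat L + 1)"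
proof -
  \<comment> \<open>Finiteness enters here: some categorical cover exists, so the minimum defining
    \<open>scat\<close> is attained.\<close>
  obtain U where U: "categorical_cover K (scat K) U"
    using LeastI_ex[OF ex_categorical_cover[OF assms(1,2)]] unfolding scat_def by blast
  obtain V where V: "categorical_cover L (scat L) V"
    using LeastI_ex[OF ex_categorical_cover[OF assms(3,4)]] unfolding scat_def by blast
  have "scat (categorical_product K L) \<le> Suc (scat K) * Suc (scat L) - 1"
    unfolding scat_def[of "categorical_product K L"]
    using categorical_cover_categorical_product[OF assms(1,3) U V] by (intro Least_le exI)
  then show ?thesis
    by simp
qed

end
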